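(* Let $X$ be a real Hilbert space with norm $\|\cdot\|_X$ and dual space $X^\star$, with duality pairing $\langle\cdot,\cdot\rangle$ on $X^\star\times X$, and let $F:X\to X^\star$ be an operator satisfying the following assumptions. (F1) There is a constant $L>0$ such that $|\langle F(u)-F(v),w\rangle|\le L\|u-v\|_X\|w\|_X$ for all $u,v,w\in X$. (F2) There is a constant $\nu>0$ such that $\langle F(u)-F(v),u-v\rangle\ge \nu\|u-v\|_X^2$ for all $u,v\in X$. (F3) $F$ is Gateaux differentiable, and there are constants $\alpha_{F'},\beta_{F'}>0$ such that for all $u\in X$: $\langle F'(u)v,v\rangle\ge\alpha_{F'}\|v\|_X^2$ for all $v\in X$, and $\langle F'(u)v,w\rangle\le\beta_{F'}\|v\|_X\|w\|_X$ for all $v,w\in X$. (F4) There is a Gateaux differentiable functional $G:X\to\mathbb{R}$ such that $G'(u)=F'(u)u$ in $X^\star$ for every $u\in X$, and $G':X\to X^\star$ is continuous with respect to the weak topology in $X^\star$. (F5) There is a Gateaux differentiable functional $H:X\to\mathbb{R}$ with $H'=F$. Let $u^0\in X$, $\sigma\in(0,1)$ and $\theta\in(0,\tfrac12]$ be arbitrary. Then the sequence $\{u^n\}$ generated by the adaptive damped Newton algorithm (described in the context) with input $u^0,\sigma,\theta$ converges strongly (i.e. in $\|\cdot\|_X$) to the unique solution $u^\star\in X$ of the equation $F(u^\star)=0$ in $X^\star$.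
   Context: Under (F1) and (F2) the equation $F(u)=0$ in $X^\star$ is known to have a unique solution $u^\star\in X$. For $u \in X$, $F'(u):X\to X^\star$ denotes the Gateaux derivative of $F$ at $u$, a linear operator. Adaptive damped Newton algorithm. It uses the constants $L$ and $\alpha_{F'}$ and the potential $H$ from the assumptions. Input: an initial guess $u^0\in X$, a correction factor $\sigma\in(0,1)$, and $\theta\in(0,\tfrac12]$. For $n=0,1,2,\dots$, given $u^n$: 1. Solve the linear problem $F'(u^n)\rho^n=F(u^n)$ for $\rho^n\in X$. 2. Set $\delta^n=1$. 3. Repeat: compute $u^{n+1}=u^n-\delta^n\rho^n$, then replace $\delta^n$ by $\max\{\sigma\delta^n,\ \alpha_{F'}/L\}$; until $$H(u^n)-H(u^{n+1})\ \ge\ \theta\min\{\alpha_{F'},L\}\,\|u^n-u^{n+1}\|_X^2 .$$ Equivalently, with trial step-sizes $\delta_0=1$ and $\delta_{j+1}=\max\{\sigma\delta_j,\alpha_{F'}/L\}$ for $j\ge0$, the next iterate is $u^{n+1}=u^n-\delta_j\rho^n$, where $j\geq 0$ is the smallest index for which the displayed inequality holds for this $u^{n+1}$. *)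

theory Defs
  imports "HOL-Analysis.Analysis"
begin

(* The difference quotients converge in norm. Linearity of the derivative is required,
   boundedness is not. *)
definition has_gateaux_derivative ::
    "('a::real_normed_vector \<Rightarrow> 'b::real_normed_vector) \<Rightarrow> ('a \<Rightarrow> 'b) \<Rightarrow> 'a \<Rightarrow> bool" where
  "has_gateaux_derivative f D u \<longleftrightarrow>
     linear D \<and>
     (\<forall>v. ((\<lambda>t::real. (f (u + t *\<^sub>R v) - f u) /\<^sub>R t) \<longlongrightarrow> D v) (at 0))"

(* The initial topology of all bounded linear functionals. On a dual space this is the
   topology induced by the bidual. *)
definition weak_topology :: "'a::real_normed_vector topology" where
  "weak_topology =
     pullback_topology UNIV (\<lambda>x. \<lambda>\<phi> :: 'a \<Rightarrow>\<^sub>L real. blinfun_apply \<phi> x) euclidean"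

lemma continuous_map_weak_topology_iff:
  fixes f :: "'b \<Rightarrow> 'a::real_normed_vector"
  shows "continuous_map T weak_topology f \<longleftrightarrow>
    (\<forall>\<phi> :: 'a \<Rightarrow>\<^sub>L real. continuous_map T euclidean (\<lambda>x. blinfun_apply \<phi> (f x)))"
proof -
  let ?e = "\<lambda>x. \<lambda>\<phi> :: 'a \<Rightarrow>\<^sub>L real. blinfun_apply \<phi> x"
  have "continuous_map T weak_topology f \<longleftrightarrow> continuous_map T euclidean (?e \<circ> f)"
  proof
    assume f: "continuous_map T weak_topology f"
    have "continuous_map weak_topology euclidean (id \<circ> ?e)"
      unfolding weak_topology_def by (rule continuous_map_pullback) simp
    with f show "continuous_map T euclidean (?e \<circ> f)"
      by (metis continuous_map_compose id_comp)
  next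
    assume "continuous_map T euclidean (?e \<circ> f)"
    then show "continuous_map T weak_topology f"
      unfolding weak_topology_def by (rule continuous_map_pullback') simp
  qed
  then show ?thesis
    unfolding euclidean_product_topology[symmetric] continuous_map_componentwise_UNIV o_def .
qed

(* For the algorithm the lower bound c is alpha / L. *)
primrec trial_step :: "real \<Rightarrow> real \<Rightarrow> nat \<Rightarrow> real" where
  "trial_step \<sigma> c 0 = 1"
| "trial_step \<sigma> c (Suc j) = max (\<sigma> * trial_step \<sigma> c j) c"

definition step_accepted ::
    "('a::real_normed_vector \<Rightarrow> real) \<Rightarrow> real \<Rightarrow> real \<Rightarrow> real \<Rightarrow> 'a \<Rightarrow> 'a \<Rightarrow> bool" where
  "step_accepted H L \<alpha> \<theta> u u' \<longleftrightarrow> H u - H u' \<ge> \<theta> * min \<alpha> L * (norm (u - u'))\<^sup>2"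

definition damped_newton_seq ::
    "('a::real_normed_vector \<Rightarrow> 'a \<Rightarrow>\<^sub>L real) \<Rightarrow> ('a \<Rightarrow> 'a \<Rightarrow> 'a \<Rightarrow>\<^sub>L real) \<Rightarrow> ('a \<Rightarrow> real) \<Rightarrow>
     real \<Rightarrow> real \<Rightarrow> real \<Rightarrow> real \<Rightarrow> 'a \<Rightarrow> (nat \<Rightarrow> 'a) \<Rightarrow> bool" where
  "damped_newton_seq F F' H L \<alpha> \<sigma> \<theta> u\<^sub>0 u \<longleftrightarrow>
     u 0 = u\<^sub>0 \<and>
     (\<forall>n. \<exists>\<rho> j. F' (u n) \<rho> = F (u n) \<and>
        u (Suc n) = u n - trial_step \<sigma> (\<alpha> / L) j *\<^sub>R \<rho> \<and>
        step_accepted H L \<alpha> \<theta> (u n) (u (Suc n)) \<and>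
        (\<forall>i<j. \<not> step_accepted H L \<alpha> \<theta> (u n) (u n - trial_step \<sigma> (\<alpha> / L) i *\<^sub>R \<rho>)))"

end

(* Each step is well posed by Lax-Milgram. With w = delta rho, the L-smoothness of the potential
   H and F(u) rho = F'(u) rho rho >= alpha |rho|^2 give
   H(u) - H(u - w) >= (alpha/delta - L/2) |w|^2, so the step size alpha/L passes the test and the
   backtracking stops. The accepted decrease and the lower bound H >= H(u_s) force
   |u^n - u^{n+1}| -> 0, hence |rho^n| -> 0 as the step sizes are at least min(1, alpha/L). Strong
   monotonicity tested with F(u^n) = F'(u^n) rho^n then gives nu |u^n - u_s| <= beta |rho^n|. *)
theory Submission
  imports Defs
begin

section \<open>Linear solvability in Hilbert space: Riesz, Zarantonello, Lax-Milgram\<close>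

text \<open>Dirichlet's principle: the representative is the minimiser of the energy
  \<open>J\<close>. Minimising sequences are Cauchy by the parallelogram law, and the first-order
  condition at the limit is the claim.\<close>

lemma riesz_representation:
  fixes \<phi> :: "'a::{real_inner, complete_space} \<Rightarrow>\<^sub>L real"
  shows "\<exists>r. \<forall>w. blinfun_apply \<phi> w = inner r w"
proof -
  define J where "J v = (norm v)\<^sup>2 / 2 - blinfun_apply \<phi> v" for v
  have lower: "- ((norm \<phi>)\<^sup>2 / 2) \<le> J v" for v
  proof -
    have "blinfun_apply \<phi> v \<le> norm \<phi> * norm v"
      using norm_blinfun[of \<phi> v] by simp
    moreover have "0 \<le> (norm \<phi> - norm v)\<^sup>2" by simp
    ultimately show ?thesis unfolding J_def power2_diff by linarith
  qed
  have bdd: "bdd_below (range J)"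
    using lower by (auto intro!: bdd_belowI)
  define m where "m = Inf (range J)"
  have m_le: "m \<le> J v" for v
    unfolding m_def by (rule cInf_lower[OF _ bdd]) simp
  \<comment> \<open>The linear part of \<open>J\<close> cancels at the midpoint, where
    \<open>J\<close> is at least \<open>m\<close>; so two points of nearly minimal energy are close.
    Excesses below \<open>e^2/8\<close> each give distance below \<open>e\<close>.\<close>
  have parallelogram: "(norm (v - w))\<^sup>2 / 4 \<le> J v + J w - 2 * m" for v w
  proof -
    have "(norm (v - w))\<^sup>2 / 4 = J v + J w - 2 * J ((1/2) *\<^sub>R (v + w))"
      unfolding J_def power2_norm_eq_inner
      by (simp add: blinfun.scaleR_right blinfun.add_right inner_add inner_diff inner_commute
          algebra_simps add_divide_distrib diff_divide_distrib)
    then show ?thesis using m_le[of "(1/2) *\<^sub>R (v + w)"] by linarith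
  qed
  have "\<exists>v. J v < m + inverse (real (Suc n))" for n
  proof -
    have "Inf (range J) < m + inverse (real (Suc n))" unfolding m_def by simp
    then show ?thesis using cInf_lessD[of "range J"] by blast
  qed
  then obtain v where v: "\<And>n. J (v n) < m + inverse (real (Suc n))" by metis
  have "Cauchy v"
  proof (rule metric_CauchyI)
    fix e :: real assume e: "0 < e"
    then have "0 < e\<^sup>2 / 8" by simp
    then obtain N where N: "inverse (real (Suc N)) < e\<^sup>2 / 8" using reals_Archimedean by blast
    have bound: "J (v n) < m + e\<^sup>2 / 8" if "n \<ge> N" for n
    proof -
      have "inverse (real (Suc n)) \<le> inverse (real (Suc N))"
        using that by (simp add: le_imp_inverse_le)
      then show ?thesis using v[of n] N by linarith
    qed
    have "dist (v n) (v k) < e" if "n \<ge> N" "k \<ge> N" for n k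
    proof -
      have "(norm (v n - v k))\<^sup>2 < e\<^sup>2"
        using parallelogram[of "v n" "v k"] bound[OF that(1)] bound[OF that(2)] by linarith
      then show ?thesis using e by (simp add: dist_norm power2_less_imp_less)
    qed
    then show "\<exists>N. \<forall>n\<ge>N. \<forall>k\<ge>N. dist (v n) (v k) < e" by blast
  qed
  then obtain r where r: "v \<longlonglongrightarrow> r"
    using Cauchy_convergent convergent_def by blast
  have "(\<lambda>n. J (v n)) \<longlonglongrightarrow> J r"
    unfolding J_def by (intro tendsto_intros r) simp
  moreover have "(\<lambda>n. m + inverse (real (Suc n))) \<longlonglongrightarrow> m"
    using tendsto_add[OF tendsto_const LIMSEQ_inverse_real_of_nat, of m] by simp
  ultimately have Jr: "J r \<le> m"
    by (rule LIMSEQ_le) (use v less_imp_le in blast)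
  have "blinfun_apply \<phi> w = inner r w" for w
  proof (cases "w = 0")
    case False
    define a where "a = inner r w - blinfun_apply \<phi> w"
    \<comment> \<open>\<open>a\<close> is the derivative of \<open>J\<close> at \<open>r\<close>
      along \<open>w\<close>, and this \<open>t\<close> minimises the quadratic
      \<open>t^2 |w|^2 / 2 + t a\<close>. Its minimum \<open>t a / 2\<close> is negative unless
      \<open>a = 0\<close>.\<close>
    define t where "t = - a / (norm w)\<^sup>2"
    have "J r \<le> J (r + t *\<^sub>R w)"
      using Jr m_le order_trans by blast
    also have "J (r + t *\<^sub>R w) = J r + t\<^sup>2 * (norm w)\<^sup>2 / 2 + t * a"
      unfolding J_def a_def power2_norm_eq_inner
      by (simp add: blinfun.scaleR_right blinfun.add_right inner_add inner_commute
          algebra_simps power2_eq_square add_divide_distrib)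
    also have "t\<^sup>2 * (norm w)\<^sup>2 / 2 = - (t * a) / 2"
      using False by (simp add: t_def power2_eq_square)
    finally have "0 \<le> t * a" by (simp add: mult.commute)
    also have "t * a = - a\<^sup>2 / (norm w)\<^sup>2"
      by (simp add: t_def power2_eq_square)
    finally have "a\<^sup>2 \<le> 0" using False by (simp add: divide_le_0_iff)
    then show ?thesis by (simp add: a_def)
  qed simp
  then show ?thesis by blast
qed

text \<open>Zarantonello's theorem. With the Riesz representative \<open>R u\<close> of \<open>A u\<close>, the damped
  Richardson map \<open>u - s R u\<close> is a contraction for \<open>s = \<mu> / K\<^sup>2\<close>.\<close>

lemma strongly_monotone_lipschitz_zero:
  fixes A :: "'a::{real_inner, complete_space} \<Rightarrow> 'a \<Rightarrow>\<^sub>L real"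
  assumes lipschitz: "\<And>u v w. \<bar>blinfun_apply (A u - A v) w\<bar> \<le> L * norm (u - v) * norm w"
    and "\<mu> > 0"
    and monotone: "\<And>u v. blinfun_apply (A u - A v) (u - v) \<ge> \<mu> * (norm (u - v))\<^sup>2"
  shows "\<exists>!u. A u = 0"
proof -
  \<comment> \<open>Still a Lipschitz constant, but positive and at least \<mu>, which keeps the
    radicand of \<open>q\<close> nonnegative.\<close>
  define K where "K = max L \<mu>"
  have K: "0 < K" "L \<le> K" "\<mu> \<le> K" using \<open>\<mu> > 0\<close> by (auto simp: K_def)
  have "\<forall>u. \<exists>r. \<forall>w. blinfun_apply (A u) w = inner r w"
    using riesz_representation by blast
  then obtain R where R: "\<And>u w. blinfun_apply (A u) w = inner (R u) w" by metis
  \<comment> \<open>Minimises \<open>1 - 2 s \<mu> + s^2 K^2\<close>, the bound on the squared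
    contraction factor; the minimum is \<open>q^2\<close>.\<close>
  define s where "s = \<mu> / K\<^sup>2"
  define q where "q = sqrt (1 - \<mu>\<^sup>2 / K\<^sup>2)"
  have "s > 0" using K \<open>\<mu> > 0\<close> by (simp add: s_def)
  have "\<mu>\<^sup>2 \<le> K\<^sup>2" using K \<open>\<mu> > 0\<close> by (intro power_mono) auto
  then have q2: "0 \<le> 1 - \<mu>\<^sup>2 / K\<^sup>2" using K by (simp add: divide_simps)
  have q: "0 \<le> q" "q < 1" using q2 K \<open>\<mu> > 0\<close> by (auto simp: q_def)
  have R_lip: "norm (R u - R v) \<le> K * norm (u - v)" for u v
  proof (cases "R u = R v")
    case False
    have "(norm (R u - R v))\<^sup>2 = blinfun_apply (A u - A v) (R u - R v)"
      by (simp add: blinfun.diff_left R power2_norm_eq_inner inner_diff_left)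
    also have "\<dots> \<le> L * norm (u - v) * norm (R u - R v)"
      using lipschitz[of u v "R u - R v"] by simp
    also have "\<dots> \<le> K * norm (u - v) * norm (R u - R v)"
      using K by (intro mult_right_mono) auto
    finally show ?thesis using False by (simp add: power2_eq_square)
  qed (use K in simp)
  have contraction: "dist (u - s *\<^sub>R R u) (v - s *\<^sub>R R v) \<le> q * dist u v" for u v
  proof -
    have "(norm ((u - s *\<^sub>R R u) - (v - s *\<^sub>R R v)))\<^sup>2
        = (norm (u - v))\<^sup>2 - 2 * s * inner (R u - R v) (u - v) + s\<^sup>2 * (norm (R u - R v))\<^sup>2"
      unfolding power2_norm_eq_inner
      by (simp add: inner_diff inner_commute algebra_simps power2_eq_square)
    also have "inner (R u - R v) (u - v) = blinfun_apply (A u - A v) (u - v)"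
      by (simp add: blinfun.diff_left R inner_diff_left)
    also have "(norm (u - v))\<^sup>2 - 2 * s * blinfun_apply (A u - A v) (u - v) + s\<^sup>2 * (norm (R u - R v))\<^sup>2
        \<le> (norm (u - v))\<^sup>2 - 2 * s * (\<mu> * (norm (u - v))\<^sup>2) + s\<^sup>2 * (K * norm (u - v))\<^sup>2"
      using monotone[of u v] R_lip[of u v] \<open>s > 0\<close>
      by (intro add_mono diff_mono mult_left_mono power_mono) auto
    also have "\<dots> = (1 - \<mu>\<^sup>2 / K\<^sup>2) * (norm (u - v))\<^sup>2"
      using K by (simp add: s_def field_simps power2_eq_square)
    also have "\<dots> = (q * norm (u - v))\<^sup>2"
      using q2 by (simp add: q_def power_mult_distrib)
    finally show ?thesis
      unfolding dist_norm by (rule power2_le_imp_le) (simp add: q)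
  qed
  have "\<exists>!u. u - s *\<^sub>R R u = u"
    by (rule banach_fix_type[OF q]) (intro allI contraction)
  moreover have "u - s *\<^sub>R R u = u \<longleftrightarrow> A u = 0" for u
  proof -
    have "u - s *\<^sub>R R u = u \<longleftrightarrow> R u = 0" using \<open>s > 0\<close> by simp
    also have "\<dots> \<longleftrightarrow> A u = 0"
      by (metis R blinfun_eqI inner_eq_zero_iff inner_zero_left zero_blinfun.rep_eq)
    finally show ?thesis .
  qed
  ultimately show ?thesis by simp
qed

text \<open>Zarantonello's theorem for the affine map \<open>B v - f\<close>: by linearity its
  differences are \<open>B (u - v)\<close>, so coercivity becomes strong monotonicity.\<close>

lemma lax_milgram:
  fixes B :: "'a::{real_inner, complete_space} \<Rightarrow> 'a \<Rightarrow>\<^sub>L real"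
  assumes "linear B"
    and bounded: "\<And>v w. blinfun_apply (B v) w \<le> \<beta> * norm v * norm w"
    and "\<alpha> > 0" and coercive: "\<And>v. blinfun_apply (B v) v \<ge> \<alpha> * (norm v)\<^sup>2"
  shows "\<exists>!v. B v = f"
proof -
  have diff: "(B u - f) - (B v - f) = B (u - v)" for u v
    using linear_diff[OF \<open>linear B\<close>] by simp
  \<comment> \<open>The bound is one-sided; testing it with \<open>- w\<close> as well gives the
    absolute value.\<close>
  have "\<bar>blinfun_apply (B v) w\<bar> \<le> \<beta> * norm v * norm w" for v w
    using bounded[of v w] bounded[of v "- w"] by (simp add: blinfun.minus_right abs_le_iff)
  then have "\<exists>!v. B v - f = 0"
    using strongly_monotone_lipschitz_zero[of "\<lambda>v. B v - f" \<beta> \<alpha>] \<open>\<alpha> > 0\<close> coercive diff by metis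
  then show ?thesis by simp
qed

section \<open>One-variable calculus for the potential along lines\<close>

lemma has_gateaux_derivative_imp_line_derivative:
  fixes f :: "'a::real_normed_vector \<Rightarrow> real"
  assumes "has_gateaux_derivative f D (u + t *\<^sub>R h)"
  shows "((\<lambda>t. f (u + t *\<^sub>R h)) has_real_derivative D h) (at t)"
proof -
  have "((\<lambda>s. (f (u + t *\<^sub>R h + s *\<^sub>R h) - f (u + t *\<^sub>R h)) / s) \<longlongrightarrow> D h) (at 0)"
    using assms unfolding has_gateaux_derivative_def by (simp add: divide_inverse_commute)
  then show ?thesis
    unfolding DERIV_def by (simp add: scaleR_add_left add.assoc)
qed

text \<open>The descent lemma. Along the segment, the potential minus its quadratic majorant has
  derivative \<open>(F (u + t h) - F u) h - L t |h|^2\<close>, nonpositive by the Lipschitz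
  bound.\<close>

lemma lipschitz_gradient_upper_bound:
  fixes F :: "'a::real_normed_vector \<Rightarrow> 'a \<Rightarrow>\<^sub>L real"
  assumes lipschitz: "\<And>u v w. \<bar>blinfun_apply (F u - F v) w\<bar> \<le> L * norm (u - v) * norm w"
    and deriv: "\<And>u. has_gateaux_derivative H (blinfun_apply (F u)) u"
  shows "H (u + h) \<le> H u + blinfun_apply (F u) h + L / 2 * (norm h)\<^sup>2"
proof -
  let ?g = "\<lambda>t. H (u + t *\<^sub>R h) - t * blinfun_apply (F u) h - L / 2 * t\<^sup>2 * (norm h)\<^sup>2"
  have "?g 1 \<le> ?g 0"
  proof (rule DERIV_nonpos_imp_nonincreasing[of 0 1 ?g])
    fix t :: real assume t: "0 \<le> t" "t \<le> 1"
    have "(?g has_real_derivative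
        (blinfun_apply (F (u + t *\<^sub>R h)) h - blinfun_apply (F u) h - L * t * (norm h)\<^sup>2)) (at t)"
      by (auto intro!: derivative_eq_intros
          has_gateaux_derivative_imp_line_derivative[OF deriv])
    moreover have "blinfun_apply (F (u + t *\<^sub>R h)) h - blinfun_apply (F u) h \<le> L * t * (norm h)\<^sup>2"
      using lipschitz[of "u + t *\<^sub>R h" u h] t
      by (simp add: blinfun.diff_left power2_eq_square mult.assoc)
    ultimately show "\<exists>y. (?g has_real_derivative y) (at t) \<and> y \<le> 0" by force
  qed simp
  then show ?thesis by simp
qed

text \<open>Monotonicity against \<open>F z = 0\<close> makes \<open>H\<close> nondecreasing along
  every ray from \<open>z\<close>. This bounds the energies of the iterates from below.\<close>

lemma critical_point_monotone_imp_minimum: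
  fixes F :: "'a::real_normed_vector \<Rightarrow> 'a \<Rightarrow>\<^sub>L real"
  assumes monotone: "\<And>u v. blinfun_apply (F u - F v) (u - v) \<ge> 0"
    and deriv: "\<And>u. has_gateaux_derivative H (blinfun_apply (F u)) u"
    and "F z = 0"
  shows "H z \<le> H u"
proof -
  let ?g = "\<lambda>t. H (z + t *\<^sub>R (u - z))"
  have "?g 0 \<le> ?g 1"
  proof (rule DERIV_nonneg_imp_nondecreasing[of 0 1 ?g])
    fix t :: real assume t: "0 \<le> t" "t \<le> 1"
    \<comment> \<open>Monotonicity only gives the sign of \<open>t\<close> times this value, so
      \<open>t = 0\<close> is settled by \<open>F z = 0\<close>.\<close>
    have "0 \<le> blinfun_apply (F (z + t *\<^sub>R (u - z))) (u - z)"
    proof (cases "t = 0")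
      case False
      have "0 \<le> t * blinfun_apply (F (z + t *\<^sub>R (u - z))) (u - z)"
        using monotone[of "z + t *\<^sub>R (u - z)" z] \<open>F z = 0\<close> by (simp add: blinfun.scaleR_right)
      then show ?thesis using False t by (simp add: zero_le_mult_iff)
    qed (simp add: \<open>F z = 0\<close>)
    then show "\<exists>y. (?g has_real_derivative y) (at t) \<and> 0 \<le> y"
      using has_gateaux_derivative_imp_line_derivative[OF deriv] by blast
  qed simp
  then show ?thesis by simp
qed

section \<open>Step sizes and termination of the backtracking\<close>

lemma trial_step_ge: "min 1 c \<le> trial_step \<sigma> c j"
  by (cases j) auto

text \<open>Once the floor \<open>c\<close> is reached it is kept, since
  \<open>\<sigma> * c \<le> c\<close>; \<open>c \<le> 1\<close> makes the formula agree with the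
  initial step 1.\<close>

lemma trial_step_eq_max:
  assumes "0 \<le> \<sigma>" "\<sigma> \<le> 1" "0 \<le> c" "c \<le> 1"
  shows "trial_step \<sigma> c j = max (\<sigma> ^ j) c"
proof (induction j)
  case (Suc j)
  have "\<sigma> * c \<le> c" using assms by (simp add: mult_left_le_one_le)
  moreover have "\<sigma> * max (\<sigma> ^ j) c = max (\<sigma> * \<sigma> ^ j) (\<sigma> * c)"
    using assms by (simp add: max_mult_distrib_left)
  ultimately show ?case using Suc by simp
qed (use assms in simp)

lemma step_accepted_exists:
  fixes F :: "'a::real_normed_vector \<Rightarrow> 'a \<Rightarrow>\<^sub>L real"
  assumes "L > 0" "\<alpha> > 0" "0 < \<sigma>" "\<sigma> < 1" "0 < \<theta>" "\<theta> \<le> 1 / 2"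
    and lipschitz: "\<And>u v w. \<bar>blinfun_apply (F u - F v) w\<bar> \<le> L * norm (u - v) * norm w"
    and deriv: "\<And>u. has_gateaux_derivative H (blinfun_apply (F u)) u"
    and descent: "blinfun_apply (F u) \<rho> \<ge> \<alpha> * (norm \<rho>)\<^sup>2"
  shows "\<exists>j. step_accepted H L \<alpha> \<theta> u (u - trial_step \<sigma> (\<alpha> / L) j *\<^sub>R \<rho>)"
proof -
  \<comment> \<open>The descent lemma at \<open>- d \<rho>\<close> gives a decrease of at least
    \<open>d \<alpha> |\<rho>|^2 - L/2 d^2 |\<rho>|^2\<close>; \<open>small\<close>, multiplied by
    \<open>d |\<rho>|^2\<close>, is what the test requires of it.\<close>
  have accepted: "step_accepted H L \<alpha> \<theta> u (u - d *\<^sub>R \<rho>)"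
    if "0 < d" and small: "d * (\<theta> * min \<alpha> L + L / 2) \<le> \<alpha>" for d
  proof -
    have "H (u - d *\<^sub>R \<rho>) \<le> H u - d * blinfun_apply (F u) \<rho> + L / 2 * (d * norm \<rho>)\<^sup>2"
      using lipschitz_gradient_upper_bound[OF lipschitz deriv, of u "- (d *\<^sub>R \<rho>)"] \<open>0 < d\<close>
      by (simp add: blinfun.minus_right blinfun.scaleR_right)
    moreover have "d * (\<alpha> * (norm \<rho>)\<^sup>2) \<le> d * blinfun_apply (F u) \<rho>"
      using descent \<open>0 < d\<close> by simp
    moreover have "d * (norm \<rho>)\<^sup>2 * (d * (\<theta> * min \<alpha> L + L / 2)) \<le> d * (norm \<rho>)\<^sup>2 * \<alpha>"
      using small \<open>0 < d\<close> by (intro mult_left_mono) auto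
    moreover have "norm (u - (u - d *\<^sub>R \<rho>)) = d * norm \<rho>"
      using \<open>0 < d\<close> by simp
    ultimately show ?thesis
      unfolding step_accepted_def power2_eq_square by (simp only:) (simp add: ring_distribs mult_ac)
  qed
  \<comment> \<open>Here \<open>\<theta> \<le> 1 / 2\<close> enters: the factor of \<open>d\<close>
    in \<open>small\<close> is then at most \<open>L\<close>, so \<open>d \<le> \<alpha> / L\<close>
    suffices.\<close>
  have \<theta>_min: "\<theta> * min \<alpha> L \<le> 1 / 2 * L"
    using assms by (intro mult_mono) auto
  show ?thesis
  \<comment> \<open>On the zero space \<open>\<alpha> > L\<close> is possible; the trial step \<open>\<alpha> / L\<close> then exceeds \<open>1\<close>.\<close>
  proof (cases "L \<le> \<alpha>")
    case True
    then have "step_accepted H L \<alpha> \<theta> u (u - trial_step \<sigma> (\<alpha> / L) 0 *\<^sub>R \<rho>)"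
      using \<theta>_min by (intro accepted) auto
    then show ?thesis ..
  next
    case False
    \<comment> \<open>Geometric decay falls below the floor, so this trial step is exactly
      \<open>\<alpha> / L\<close>.\<close>
    obtain j where "\<sigma> ^ j < \<alpha> / L"
      using real_arch_pow_inv[of "\<alpha> / L" \<sigma>] assms by auto
    then have "trial_step \<sigma> (\<alpha> / L) j = \<alpha> / L"
      using trial_step_eq_max[of \<sigma> "\<alpha> / L" j] assms False by simp
    moreover have "\<alpha> / L * (\<theta> * min \<alpha> L + L / 2) \<le> \<alpha> / L * L"
      using \<theta>_min assms by (intro mult_left_mono) auto
    then have "step_accepted H L \<alpha> \<theta> u (u - (\<alpha> / L) *\<^sub>R \<rho>)"
      using assms by (intro accepted) auto
    ultimately show ?thesis by metis
  qed
qed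

text \<open>The second conjunct says that the algorithm is well defined, its inner loop terminating
  at every iterate, and so keeps the convergence claim from being vacuous.\<close>

theorem theorem4p1:
  fixes F :: "'a::{real_inner, complete_space} \<Rightarrow> 'a \<Rightarrow>\<^sub>L real"
    and F' :: "'a \<Rightarrow> 'a \<Rightarrow> 'a \<Rightarrow>\<^sub>L real"
    and G H :: "'a \<Rightarrow> real"
    and G' :: "'a \<Rightarrow> 'a \<Rightarrow>\<^sub>L real"
    and L \<nu> \<alpha> \<beta> \<sigma> \<theta> :: real
    and u\<^sub>0 :: 'a
  assumes L_pos: "L > 0"
    and F1: "\<And>u v w. \<bar>blinfun_apply (F u - F v) w\<bar> \<le> L * norm (u - v) * norm w"
    and \<nu>_pos: "\<nu> > 0"
    and F2: "\<And>u v. blinfun_apply (F u - F v) (u - v) \<ge> \<nu> * (norm (u - v))\<^sup>2"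
    and F3_deriv: "\<And>u. has_gateaux_derivative F (F' u) u"
    and \<alpha>_pos: "\<alpha> > 0"
    and \<beta>_pos: "\<beta> > 0"
    and F3_coercive: "\<And>u v. blinfun_apply (F' u v) v \<ge> \<alpha> * (norm v)\<^sup>2"
    and F3_bounded: "\<And>u v w. blinfun_apply (F' u v) w \<le> \<beta> * norm v * norm w"
    and F4_deriv: "\<And>u. has_gateaux_derivative G (blinfun_apply (G' u)) u"
    and F4_eq: "\<And>u. G' u = F' u u"
    and F4_cont: "continuous_map euclidean weak_topology G'"
    and F5: "\<And>u. has_gateaux_derivative H (blinfun_apply (F u)) u"
    and \<sigma>: "0 < \<sigma>" "\<sigma> < 1"
    and \<theta>: "0 < \<theta>" "\<theta> \<le> 1 / 2"
  shows "(\<exists>!u\<^sub>s. F u\<^sub>s = 0) \<and>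
    (\<exists>!u. damped_newton_seq F F' H L \<alpha> \<sigma> \<theta> u\<^sub>0 u) \<and>
    (\<forall>u u\<^sub>s. damped_newton_seq F F' H L \<alpha> \<sigma> \<theta> u\<^sub>0 u \<longrightarrow> F u\<^sub>s = 0 \<longrightarrow> u \<longlonglongrightarrow> u\<^sub>s)"
proof -

  \<comment> \<open>Well-posedness of the iteration\<close>
  have linear_F': "linear (F' u)" for u
    using F3_deriv unfolding has_gateaux_derivative_def by blast
  have solve: "\<exists>!\<rho>. F' u \<rho> = F u" for u
    using lax_milgram[OF linear_F' F3_bounded \<alpha>_pos F3_coercive] .
  define step where "step u u' \<longleftrightarrow> (\<exists>\<rho> j. F' u \<rho> = F u \<and>
        u' = u - trial_step \<sigma> (\<alpha> / L) j *\<^sub>R \<rho> \<and>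
        step_accepted H L \<alpha> \<theta> u u' \<and>
        (\<forall>i<j. \<not> step_accepted H L \<alpha> \<theta> u (u - trial_step \<sigma> (\<alpha> / L) i *\<^sub>R \<rho>)))" for u u'
  have seq_iff: "damped_newton_seq F F' H L \<alpha> \<sigma> \<theta> u\<^sub>0 u \<longleftrightarrow>
      u 0 = u\<^sub>0 \<and> (\<forall>n. step (u n) (u (Suc n)))" for u
    unfolding damped_newton_seq_def step_def ..
  have step_ex1: "\<exists>!u'. step u u'" for u
  proof -
    obtain \<rho> where \<rho>: "F' u \<rho> = F u" and unique: "\<And>\<rho>'. F' u \<rho>' = F u \<Longrightarrow> \<rho>' = \<rho>"
      using solve by metis
    define P where "P j \<longleftrightarrow> step_accepted H L \<alpha> \<theta> u (u - trial_step \<sigma> (\<alpha> / L) j *\<^sub>R \<rho>)" for j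
    have "\<exists>j. P j"
      unfolding P_def
      by (rule step_accepted_exists[OF L_pos \<alpha>_pos \<sigma> \<theta> F1 F5]) (use F3_coercive[where u=u and v=\<rho>] \<rho> in simp)
    then have least: "P (LEAST j. P j)" by (rule LeastI_ex)
    \<comment> \<open>Unique solvability fixes the direction, and the first accepted index fixes the
      step size; hence \<open>step\<close> is the graph of a function, and the sequence is defined
      by recursion.\<close>
    have "step u u' \<longleftrightarrow> u' = u - trial_step \<sigma> (\<alpha> / L) (LEAST j. P j) *\<^sub>R \<rho>" for u'
    proof
      assume "step u u'"
      then obtain j where j: "u' = u - trial_step \<sigma> (\<alpha> / L) j *\<^sub>R \<rho>" "P j" "\<forall>i<j. \<not> P i"
        unfolding step_def P_def using unique by metis
      then have "(LEAST j. P j) = j" by (metis Least_equality not_less)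
      with j show "u' = u - trial_step \<sigma> (\<alpha> / L) (LEAST j. P j) *\<^sub>R \<rho>" by simp
    next
      assume "u' = u - trial_step \<sigma> (\<alpha> / L) (LEAST j. P j) *\<^sub>R \<rho>"
      then show "step u u'"
        unfolding step_def using \<rho> least not_less_Least[of _ P] P_def by blast
    qed
    then show ?thesis by simp
  qed
  have existence: "\<exists>!u. damped_newton_seq F F' H L \<alpha> \<sigma> \<theta> u\<^sub>0 u"
  proof
    define next_iterate where "next_iterate u = (THE u'. step u u')" for u
    have next_iterate: "step u (next_iterate u)" for u
      unfolding next_iterate_def by (rule theI'[OF step_ex1])
    show "damped_newton_seq F F' H L \<alpha> \<sigma> \<theta> u\<^sub>0 (rec_nat u\<^sub>0 (\<lambda>_. next_iterate))"
      unfolding seq_iff by (simp add: next_iterate)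
    fix u assume u: "damped_newton_seq F F' H L \<alpha> \<sigma> \<theta> u\<^sub>0 u"
    have "u n = rec_nat u\<^sub>0 (\<lambda>_. next_iterate) n" for n
    proof (induction n)
      case (Suc n)
      then show ?case using u next_iterate step_ex1 unfolding seq_iff by (metis old.nat.simps(7))
    qed (use u seq_iff in simp)
    then show "u = rec_nat u\<^sub>0 (\<lambda>_. next_iterate)" by blast
  qed

  \<comment> \<open>Strong convergence to the zero of \<open>F\<close>\<close>
  have convergence: "u \<longlonglongrightarrow> z"
    if seq: "damped_newton_seq F F' H L \<alpha> \<sigma> \<theta> u\<^sub>0 u" and z: "F z = 0" for u z
  proof -
    \<comment> \<open>A lower bound for every trial step, including the initial step 1 when
      \<open>\<alpha> / L\<close> exceeds it.\<close>
    define c where "c = min 1 (\<alpha> / L)"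
    define k where "k = \<theta> * min \<alpha> L"
    have c: "c > 0" and k: "k > 0"
      using L_pos \<alpha>_pos \<theta> by (auto simp: c_def k_def)
    have decrease: "k * (norm (u n - u (Suc n)))\<^sup>2 \<le> H (u n) - H (u (Suc n))" for n
      using seq unfolding damped_newton_seq_def step_accepted_def k_def by blast
    have "H (u (Suc n)) \<le> H (u n)" for n
      using decrease[of n] k by (smt (verit) zero_le_mult_iff zero_le_power2)
    then have "decseq (\<lambda>n. H (u n))" by (rule decseq_SucI)
    moreover have "H z \<le> H (u n)" for n
    proof (rule critical_point_monotone_imp_minimum[OF _ F5 z])
      show "blinfun_apply (F u - F v) (u - v) \<ge> 0" for u v
        using F2[of u v] \<nu>_pos by (smt (verit) zero_le_mult_iff zero_le_power2)
    qed
    ultimately obtain l where l: "(\<lambda>n. H (u n)) \<longlonglongrightarrow> l"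
      using decseq_convergent[of "\<lambda>n. H (u n)" "H z"] by blast
    \<comment> \<open>The energies and their shift share the limit \<open>l\<close>, so the
      decreases vanish, and with them the increments they dominate.\<close>
    have "(\<lambda>n. (H (u n) - H (u (Suc n))) / k) \<longlonglongrightarrow> (l - l) / k"
      using k by (intro tendsto_intros l LIMSEQ_Suc[OF l]) simp
    then have quotient: "(\<lambda>n. (H (u n) - H (u (Suc n))) / k) \<longlonglongrightarrow> 0" by simp
    have "(\<lambda>n. (norm (u n - u (Suc n)))\<^sup>2) \<longlonglongrightarrow> 0"
      by (rule tendsto_sandwich[OF _ _ tendsto_const quotient])
        (use decrease k in \<open>auto simp: field_simps\<close>)
    then have increments: "(\<lambda>n. norm (u n - u (Suc n))) \<longlonglongrightarrow> 0"
      using tendsto_real_sqrt[of "\<lambda>n. (norm (u n - u (Suc n)))\<^sup>2" 0] by simp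
    \<comment> \<open>An a posteriori estimate: the increment controls the true error with a
      constant independent of \<open>n\<close>, so vanishing increments yield convergence of the
      whole sequence.\<close>
    have error: "norm (u n - z) \<le> \<beta> / (\<nu> * c) * norm (u n - u (Suc n))" for n
    proof -
      obtain \<rho> j where \<rho>: "F' (u n) \<rho> = F (u n)"
        and u_Suc: "u (Suc n) = u n - trial_step \<sigma> (\<alpha> / L) j *\<^sub>R \<rho>"
        using seq unfolding damped_newton_seq_def by blast
      have "c * norm \<rho> \<le> \<bar>trial_step \<sigma> (\<alpha> / L) j\<bar> * norm \<rho>"
        using trial_step_ge[of "\<alpha> / L" \<sigma> j] by (intro mult_right_mono) (auto simp: c_def)
      then have \<rho>_le: "c * norm \<rho> \<le> norm (u n - u (Suc n))" using u_Suc by simp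
      have "\<nu> * (norm (u n - z))\<^sup>2 \<le> blinfun_apply (F' (u n) \<rho>) (u n - z)"
        using F2[of "u n" z] z \<rho> by simp
      also have "\<dots> \<le> \<beta> * norm \<rho> * norm (u n - z)" by (rule F3_bounded)
      \<comment> \<open>One factor \<open>norm (u n - z)\<close> is cancelled; if it is zero, the
        right side is nonnegative anyway.\<close>
      finally have "\<nu> * norm (u n - z) \<le> \<beta> * norm \<rho>"
        using \<beta>_pos by (cases "u n = z") (auto simp: power2_eq_square)
      then have "c * (\<nu> * norm (u n - z)) \<le> \<beta> * (c * norm \<rho>)"
        using c by simp
      also have "\<dots> \<le> \<beta> * norm (u n - u (Suc n))"
        using \<rho>_le \<beta>_pos by simp
      finally show ?thesis using c \<nu>_pos by (simp add: pos_le_divide_eq mult_ac)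
    qed
    have "(\<lambda>n. \<beta> / (\<nu> * c) * norm (u n - u (Suc n))) \<longlonglongrightarrow> 0"
      using tendsto_mult_right_zero[OF increments] .
    then have "(\<lambda>n. u n - z) \<longlonglongrightarrow> 0"
      by (rule Lim_null_comparison[rotated]) (intro always_eventually allI error)
    then show ?thesis by (simp add: LIM_zero_iff)
  qed
  show ?thesis
    using strongly_monotone_lipschitz_zero[OF F1 \<nu>_pos F2] existence convergence by blast
qed

end
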